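(* Let $G$ be an infinite connected graph of bounded degree which has compression exponent, in some $L^p$-space with $1\le p<\infty$, equal to $\alpha>0$. Then, for any $c<\frac{\alpha}{2-\alpha}$, there is a constant $K$ such that for any integer $N\ge 2$, $$\frac{\mathrm{Sep}_G(N)}{N}\le\frac{K}{(\log N)^c}.$$
   Context: Let $d$ be the combinatorial distance on $G$. For a 1-Lipschitz map $\Phi$ from the vertex set of $G$ to an $L^p$-space, a compression function for $\Phi$ is a function $\rho$ such that $\rho(d(x,y))\le\|\Phi(x)-\Phi(y)\|_{L^p}$ for all vertices $x,y$. The compression exponent of $\Phi$ is $\alpha(\Phi)=\liminf_{x\to\infty}\frac{\log\rho(x)}{\log x}$, where $\rho$ is the largest compression function for $\Phi$, and the compression exponent of $G$ (in $L^p$) is $\alpha(G)=\sup_\Phi\alpha(\Phi)$, the supremum being over 1-Lipschitz embeddings into $L^p$-spaces (for this $p$). A graph $G$ has vertex set $VG$ and edge set $EG\subset VG\times VG$; adjacency is undirected. For $A\subset VG$, $\partial A=\{(a,b)\in EG : \text{exactly one of } a,b \text{ lies in } A\}$. For a finite graph $H$, the Cheeger constant is $h(H)=\min\{|\partial_H A|/|A| : \emptyset\ne A\subset VH,\ |A|\le |VH|/2\}$, where $\partial_H$ is the boundary in $H$. For a finite $F\subset VG$, $h(F)$ is the Cheeger constant of the subgraph of $G$ induced on $F$, with the convention $h(F)=0$ if $|F|\le1$. The separation profile is $\mathrm{Sep}_G(n)=\sup\{|F|\, h(F) : F\subset VG,\ |F|\le n\}$. *)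

theory Defs
  imports "HOL-Analysis.Analysis" "Graph_Theory.Graph_Theory"
begin

text \<open>
  A graph is a \<^typ>\<open>'a pair_pre_digraph\<close> with edge set contained in the square of its vertex set.
  The edge set is not required to be symmetric: an undirected edge may be listed in one orientation
  or in both. Adjacency, degrees, distance and connectedness are those of the underlying undirected
  graph \<^const>\<open>mk_symmetric\<close>, which is also what \<^const>\<open>Digraph_Component.connected\<close> refers to.
\<close>

definition bounded_degree :: "'a pair_pre_digraph \<Rightarrow> bool" where
  "bounded_degree G \<longleftrightarrow>
     (\<exists>D. \<forall>v \<in> pverts G. finite {u. v \<rightarrow>\<^bsub>mk_symmetric G\<^esub> u} \<and> card {u. v \<rightarrow>\<^bsub>mk_symmetric G\<^esub> u} \<le> D)"

text \<open>Only meaningful for vertices of a connected graph.\<close>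

definition graph_dist :: "'a pair_pre_digraph \<Rightarrow> 'a \<Rightarrow> 'a \<Rightarrow> nat" where
  "graph_dist G x y = (LEAST n. \<exists>w. pre_digraph.awalk (mk_symmetric G) x w y \<and> length w = n)"


subsection \<open>Separation profile\<close>

definition edge_boundary :: "('a, 'e) pre_digraph \<Rightarrow> 'a set \<Rightarrow> 'e set" where
  "edge_boundary H A = {e \<in> arcs H. (tail H e \<in> A) \<noteq> (head H e \<in> A)}"

text \<open>For finite graphs with at least two vertices, so that the minimum is over a finite nonempty set.\<close>

definition cheeger :: "('a, 'e) pre_digraph \<Rightarrow> real" where
  "cheeger H = Min {real (card (edge_boundary H A)) / real (card A) | A.
     A \<noteq> {} \<and> A \<subseteq> verts H \<and> real (card A) \<le> real (card (verts H)) / 2}"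

definition cheeger_on :: "'a pair_pre_digraph \<Rightarrow> 'a set \<Rightarrow> real" where
  "cheeger_on G F = (if card F \<le> 1 then 0 else cheeger (with_proj G \<restriction> F))"

text \<open>A supremum in the reals; it is over a bounded set when \<^term>\<open>G\<close> has bounded degree.\<close>

definition Sep :: "'a pair_pre_digraph \<Rightarrow> nat \<Rightarrow> real" where
  "Sep G n = (SUP F \<in> {F. F \<subseteq> pverts G \<and> finite F \<and> card F \<le> n}. real (card F) * cheeger_on G F)"


subsection \<open>Compression\<close>

text \<open>
  Elements of real \<open>L\<^sup>p(M)\<close> are given by representatives; all notions below depend only on their
  classes modulo equality almost everywhere.
\<close>

definition Lp_space :: "real \<Rightarrow> 'b measure \<Rightarrow> ('b \<Rightarrow> real) set" where
  "Lp_space p M = {f \<in> borel_measurable M. integrable M (\<lambda>t. \<bar>f t\<bar> powr p)}"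

definition Lp_norm :: "real \<Rightarrow> 'b measure \<Rightarrow> ('b \<Rightarrow> real) \<Rightarrow> real" where
  "Lp_norm p M f = (\<integral>t. \<bar>f t\<bar> powr p \<partial>M) powr (1 / p)"

definition Lp_dist :: "real \<Rightarrow> 'b measure \<Rightarrow> ('b \<Rightarrow> real) \<Rightarrow> ('b \<Rightarrow> real) \<Rightarrow> real" where
  "Lp_dist p M f g = Lp_norm p M (\<lambda>t. f t - g t)"

definition lipschitz_embedding ::
    "real \<Rightarrow> 'a pair_pre_digraph \<Rightarrow> 'b measure \<Rightarrow> ('a \<Rightarrow> 'b \<Rightarrow> real) \<Rightarrow> bool" where
  "lipschitz_embedding p G M \<Phi> \<longleftrightarrow>
     (\<forall>x \<in> pverts G. \<Phi> x \<in> Lp_space p M) \<and>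
     (\<forall>x \<in> pverts G. \<forall>y \<in> pverts G. Lp_dist p M (\<Phi> x) (\<Phi> y) \<le> real (graph_dist G x y)) \<and>
     (\<forall>x \<in> pverts G. \<forall>y \<in> pverts G. x \<noteq> y \<longrightarrow> Lp_dist p M (\<Phi> x) (\<Phi> y) \<noteq> 0)"

definition compression_function ::
    "real \<Rightarrow> 'a pair_pre_digraph \<Rightarrow> 'b measure \<Rightarrow> ('a \<Rightarrow> 'b \<Rightarrow> real) \<Rightarrow> (nat \<Rightarrow> real) \<Rightarrow> bool" where
  "compression_function p G M \<Phi> \<rho> \<longleftrightarrow>
     (\<forall>x \<in> pverts G. \<forall>y \<in> pverts G. \<rho> (graph_dist G x y) \<le> Lp_dist p M (\<Phi> x) (\<Phi> y))"

text \<open>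
  Greatest in the pointwise order. It exists when every natural number is a distance between two
  vertices, in particular for infinite connected graphs of bounded degree.
\<close>

definition largest_compression ::
    "real \<Rightarrow> 'a pair_pre_digraph \<Rightarrow> 'b measure \<Rightarrow> ('a \<Rightarrow> 'b \<Rightarrow> real) \<Rightarrow> nat \<Rightarrow> real" where
  "largest_compression p G M \<Phi> = (GREATEST \<rho>. compression_function p G M \<Phi> \<rho>)"

text \<open>The logarithm with \<open>log 0 = -\<infinity>\<close>, as opposed to the library's \<^prop>\<open>ln (0::real) = 0\<close>.\<close>

definition eln :: "real \<Rightarrow> ereal" where
  "eln r = (if r \<le> 0 then -\<infinity> else ereal (ln r))"

definition map_compression_exponent ::
    "real \<Rightarrow> 'a pair_pre_digraph \<Rightarrow> 'b measure \<Rightarrow> ('a \<Rightarrow> 'b \<Rightarrow> real) \<Rightarrow> ereal" where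
  "map_compression_exponent p G M \<Phi> =
     liminf (\<lambda>n. eln (largest_compression p G M \<Phi> n) / eln (real n))"

text \<open>
  HOL cannot quantify over all types inside a formula, so the supremum ranges over the measure spaces
  whose points have a given type \<^typ>\<open>'b\<close>. Statements about it are to be made for an arbitrary
  type \<^typ>\<open>'b\<close>; already \<^typ>\<open>real\<close> gives the supremum over all measure spaces when the graph is
  countable, since separable subspaces of \<open>L\<^sup>p\<close>-spaces embed isometrically in \<open>L\<^sup>p([0,1])\<close>.
\<close>

definition compression_exponent :: "'b itself \<Rightarrow> real \<Rightarrow> 'a pair_pre_digraph \<Rightarrow> ereal" where
  "compression_exponent _ p G =
     (SUP (M :: 'b measure, \<Phi>) \<in> {(M, \<Phi>). lipschitz_embedding p G M \<Phi>}.
        map_compression_exponent p G M \<Phi>)"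

end

theory Submission
  imports Defs
begin

text \<open>
  A finite \<open>F\<close> with Cheeger constant \<open>h\<close> satisfies, by the coarea formula applied to \<open>p\<close>-th powers, a
  Poincare inequality in \<open>L\<^sup>p\<close> with constant of order \<open>h\<^sup>-\<^sup>p\<close>. Applied to a 1-Lipschitz map this says
  that the image points of \<open>F\<close> are at average distance \<open>O(1/h)\<close>. Balls grow at most exponentially, so
  half of the pairs in \<open>F\<close> are at graph distance at least \<open>r\<close>, of order \<open>log |F|\<close>, hence have images at
  distance at least \<open>r\<^sup>b\<close> for each \<open>b < \<alpha>\<close>. Therefore \<open>h = O((log |F|)\<^sup>-\<^sup>b)\<close>. Since \<open>\<alpha> \<le> 1\<close> for an infinite
  connected graph, \<open>\<alpha>/(2 - \<alpha>) \<le> \<alpha>\<close>, so this covers the claimed range of exponents.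
\<close>

subsection \<open>Powers and medians\<close>

text \<open>A crude form of Young's inequality: replacing the smaller of \<open>x\<close> and
  \<open>y\<close> by the larger bounds the product by a single \<open>p\<close>-th power.\<close>

lemma mult_powr_le_sum_powr:
  fixes x y p :: real
  assumes "0 \<le> x" "0 \<le> y" "1 \<le> p"
  shows "x * y powr (p - 1) \<le> x powr p + y powr p"
proof (cases "x \<le> y")
  case True
  then have "x * y powr (p - 1) \<le> y * y powr (p - 1)"
    by (intro mult_right_mono) auto
  also have "\<dots> = y powr p"
    using assms by (simp add: powr_mult_base)
  finally show ?thesis by (simp add: add_increasing)
next
  case False
  then have "x * y powr (p - 1) \<le> x * x powr (p - 1)"
    using assms by (intro mult_left_mono powr_mono2) auto
  also have "\<dots> = x powr p"
    using assms by (simp add: powr_mult_base)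
  finally show ?thesis by (simp add: add_increasing2)
qed

lemma powr_diff_le_mean_value:
  fixes a b p :: real
  assumes "0 \<le> b" "b < a" "1 \<le> p"
  shows "a powr p - b powr p \<le> p * (a - b) * a powr (p - 1)"
proof (cases "b = 0")
  \<comment> \<open>The endpoint 0 is treated by hand because the derivative rule for
    \<open>powr\<close> needs a positive base.\<close>
  case True
  have "a * a powr (p - 1) \<le> p * (a * a powr (p - 1))"
    using assms mult_right_mono[of 1 p "a * a powr (p - 1)"] by simp
  then show ?thesis using True assms by (simp add: powr_mult_base mult.assoc)
next
  case False
  have "\<exists>z>b. z < a \<and> a powr p - b powr p = (a - b) * (p * z powr (p - 1))"
    using assms False by (intro MVT2) (auto intro!: derivative_eq_intros)
  then obtain z where z: "b < z" "z < a"
    "a powr p - b powr p = (a - b) * (p * z powr (p - 1))" by blast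
  have "z powr (p - 1) \<le> a powr (p - 1)"
    using z assms by (intro powr_mono2) auto
  then have "(a - b) * (p * z powr (p - 1)) \<le> (a - b) * (p * a powr (p - 1))"
    using assms by (intro mult_left_mono) auto
  with z(3) show ?thesis by (simp add: mult_ac)
qed

text \<open>Young's inequality at scale \<open>\<epsilon>\<close> splits the mean value bound into a
  gradient term and a term in \<open>a powr p + b powr p\<close> whose coefficient is small with
  \<open>\<epsilon>\<close>, so that it can later be absorbed.\<close>

lemma abs_powr_diff_le:
  fixes a b p \<epsilon> :: real
  assumes "0 \<le> a" "0 \<le> b" "1 \<le> p" "0 < \<epsilon>"
  shows "\<bar>a powr p - b powr p\<bar> \<le> p * \<epsilon> * ((\<bar>a - b\<bar> / \<epsilon>) powr p + (a powr p + b powr p))"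
proof -
  have *: "\<bar>a powr p - b powr p\<bar> \<le> p * \<epsilon> * ((\<bar>a - b\<bar> / \<epsilon>) powr p + (a powr p + b powr p))"
    if "0 \<le> b" "b < a" for a b :: real
  proof -
    have "b powr p \<le> a powr p" using that assms by (intro powr_mono2) auto
    then have "\<bar>a powr p - b powr p\<bar> \<le> p * (a - b) * a powr (p - 1)"
      using powr_diff_le_mean_value[OF that assms(3)] by simp
    also have "\<dots> = p * \<epsilon> * ((a - b) / \<epsilon> * a powr (p - 1))"
      using assms by simp
    also have "\<dots> \<le> p * \<epsilon> * (((a - b) / \<epsilon>) powr p + a powr p)"
      using that assms by (intro mult_left_mono mult_powr_le_sum_powr) auto
    also have "\<dots> \<le> p * \<epsilon> * ((\<bar>a - b\<bar> / \<epsilon>) powr p + (a powr p + b powr p))"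
      using that assms by (intro mult_left_mono) auto
    finally show ?thesis .
  qed
  consider "b < a" | "a < b" | "a = b" by linarith
  then show ?thesis
  proof cases
    case 1 then show ?thesis using *[of b a] assms by simp
  next
    case 2 then show ?thesis using *[of a b] assms
      by (simp add: abs_minus_commute add.commute)
  next
    case 3 then show ?thesis using assms by simp
  qed
qed

lemma powr_add_le:
  fixes a b p :: real
  assumes "0 \<le> a" "0 \<le> b" "0 \<le> p"
  shows "(a + b) powr p \<le> 2 powr p * (a powr p + b powr p)"
proof -
  have "(a + b) powr p \<le> (2 * max a b) powr p"
    using assms by (intro powr_mono2) auto
  also have "\<dots> = 2 powr p * (max a b) powr p"
    using assms by (simp add: powr_mult)
  also have "\<dots> \<le> 2 powr p * (a powr p + b powr p)"
    by (intro mult_left_mono) (auto simp: max_def)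
  finally show ?thesis .
qed

text \<open>Take \<open>m\<close> least among the values with at most half of \<open>F\<close>
  strictly above. If more than half lay strictly below \<open>m\<close>, the largest value below
  \<open>m\<close> would qualify too. Strict inequalities on both sides allow ties at
  \<open>m\<close>.\<close>

lemma median_exists:
  fixes f :: "'a \<Rightarrow> real"
  assumes "finite F"
  obtains m where "2 * card {x \<in> F. m < f x} \<le> card F" "2 * card {x \<in> F. f x < m} \<le> card F"
proof (cases "F = {}")
  case True
  then show ?thesis using that by auto
next
  case False
  define V where "V = {v \<in> f ` F. 2 * card {x \<in> F. v < f x} \<le> card F}"
  have fin: "finite V" using assms by (auto simp: V_def)
  have "{x \<in> F. Max (f ` F) < f x} = {}"
    using assms by (auto simp: not_less)
  then have "Max (f ` F) \<in> V"
    using assms False unfolding V_def by (simp only: mem_Collect_eq) auto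
  then have ne: "V \<noteq> {}" by auto
  define m where "m = Min V"
  have "m \<in> V" using fin ne m_def by auto
  moreover have "2 * card {x \<in> F. f x < m} \<le> card F"
  proof (rule ccontr)
    let ?L = "{x \<in> F. f x < m}"
    assume *: "\<not> ?thesis"
    then have L: "?L \<noteq> {}" by (metis card.empty mult_0_right zero_le)
    define v where "v = Max (f ` ?L)"
    have "v \<in> f ` ?L" unfolding v_def using assms L by (intro Max_in) auto
    then have v: "v \<in> f ` F" "v < m" by auto
    have "f x \<le> v" if "x \<in> ?L" for x
      unfolding v_def using assms that by (intro Max_ge) auto
    then have "{x \<in> F. v < f x} \<subseteq> F - ?L" by force
    then have "card {x \<in> F. v < f x} \<le> card (F - ?L)"
      using assms by (intro card_mono) auto
    also have "\<dots> = card F - card ?L"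
      using assms by (intro card_Diff_subset) auto
    finally have "v \<in> V" using * v by (auto simp: V_def)
    then have "m \<le> v" using fin by (auto simp: m_def)
    with v show False by simp
  qed
  ultimately show ?thesis using that by (auto simp: V_def)
qed

subsection \<open>Poincare inequalities from the Cheeger constant\<close>

text \<open>Edges are ordered pairs and an undirected edge may occur in one orientation or in both,
  so outgoing and incoming degrees are bounded separately.\<close>

locale finite_isoperimetric =
  fixes F :: "'a set" and E :: "('a \<times> 'a) set" and h D :: real
  assumes finite_F: "finite F"
    and E_subset: "E \<subseteq> F \<times> F"
    and h_pos: "0 < h"
    and D_pos: "0 < D"
    and isoperimetric: "\<And>A. A \<noteq> {} \<Longrightarrow> A \<subseteq> F \<Longrightarrow> 2 * card A \<le> card F \<Longrightarrow>
      h * card A \<le> card {e \<in> E. (fst e \<in> A) \<noteq> (snd e \<in> A)}"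
    and out_degree: "\<And>x. x \<in> F \<Longrightarrow> card {y. (x, y) \<in> E} \<le> D"
    and in_degree: "\<And>x. x \<in> F \<Longrightarrow> card {y. (y, x) \<in> E} \<le> D"
begin

lemma finite_E: "finite E"
  using finite_F E_subset by (meson finite_SigmaI finite_subset)

lemma sum_fst_le:
  assumes "\<And>x. x \<in> F \<Longrightarrow> 0 \<le> k x"
  shows "(\<Sum>e\<in>E. k (fst e)) \<le> D * (\<Sum>x\<in>F. k x)"
proof -
  have "E = (SIGMA x:F. {y. (x, y) \<in> E})" using E_subset by auto
  then have "(\<Sum>e\<in>E. k (fst e)) = (\<Sum>e\<in>(SIGMA x:F. {y. (x, y) \<in> E}). k (fst e))" by simp
  also have "\<dots> = (\<Sum>x\<in>F. \<Sum>y\<in>{y. (x, y) \<in> E}. k x)"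
    using finite_F E_subset
    by (subst sum.Sigma) (auto intro!: finite_subset[of _ F] sum.cong)
  also have "\<dots> = (\<Sum>x\<in>F. card {y. (x, y) \<in> E} * k x)" by simp
  also have "\<dots> \<le> (\<Sum>x\<in>F. D * k x)"
    using assms out_degree by (intro sum_mono mult_right_mono) auto
  finally show ?thesis by (simp add: sum_distrib_left)
qed

text \<open>Reversing edges preserves boundaries and exchanges the two degree bounds; this transfers
  \<open>sum_fst_le\<close> to second endpoints.\<close>

lemma converse_isoperimetric: "finite_isoperimetric F (E\<inverse>) h D"
proof
  fix A assume A: "A \<noteq> {}" "A \<subseteq> F" "2 * card A \<le> card F"
  have "{e \<in> E\<inverse>. (fst e \<in> A) \<noteq> (snd e \<in> A)} = prod.swap ` {e \<in> E. (fst e \<in> A) \<noteq> (snd e \<in> A)}"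
    by (auto simp: image_iff)
  also have "card \<dots> = card {e \<in> E. (fst e \<in> A) \<noteq> (snd e \<in> A)}"
    by (rule card_image) simp
  finally show "h * card A \<le> card {e \<in> E\<inverse>. (fst e \<in> A) \<noteq> (snd e \<in> A)}"
    using isoperimetric[OF A] by simp
qed (use finite_F E_subset h_pos D_pos out_degree in_degree in auto)

lemma sum_snd_le:
  assumes "\<And>x. x \<in> F \<Longrightarrow> 0 \<le> k x"
  shows "(\<Sum>e\<in>E. k (snd e)) \<le> D * (\<Sum>x\<in>F. k x)"
proof -
  have "(\<Sum>e\<in>E. k (snd e)) = (\<Sum>e\<in>E\<inverse>. k (fst e))"
    by (rule sum.reindex_bij_witness[of _ prod.swap prod.swap]) auto
  also have "\<dots> \<le> D * (\<Sum>x\<in>F. k x)"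
    using finite_isoperimetric.sum_fst_le[OF converse_isoperimetric] assms by blast
  finally show ?thesis .
qed

text \<open>The discrete coarea inequality, by induction on the size of the support. Each superlevel
  set of \<open>g\<close> inside its support has at most half of the points, so the isoperimetric
  inequality applies to every layer.\<close>

lemma coarea:
  assumes "\<And>x. x \<in> F \<Longrightarrow> 0 \<le> g x" "2 * card {x \<in> F. 0 < g x} \<le> card F"
  shows "h * (\<Sum>x\<in>F. g x) \<le> (\<Sum>e\<in>E. \<bar>g (fst e) - g (snd e)\<bar>)"
  using assms
proof (induction "card {x \<in> F. 0 < g x}" arbitrary: g rule: less_induct)
  case less
  define S where "S = {x \<in> F. 0 < g x}"
  have finS: "finite S" and SF: "S \<subseteq> F" using finite_F by (auto simp: S_def)
  show ?case
  proof (cases "S = {}")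
    case True
    then have "g x = 0" if "x \<in> F" for x
      using less.prems(1)[OF that] that by (force simp: S_def)
    then show ?thesis by (simp add: sum_nonneg)
  next
    case False
    \<comment> \<open>remove the lowest layer of \<open>g\<close>: subtract the least positive value on the support\<close>
    define m where "m = Min (g ` S)"
    have "m \<in> g ` S" unfolding m_def using finS False by (intro Min_in) auto
    then obtain x0 where x0: "x0 \<in> S" "g x0 = m" by auto
    have m: "0 < m" using x0 by (auto simp: S_def)
    have m_le: "m \<le> g x" if "x \<in> S" for x using that finS by (auto simp: m_def)
    have zero: "g x = 0" if "x \<in> F" "x \<notin> S" for x
      using less.prems(1)[OF that(1)] that by (force simp: S_def)
    define g' where "g' x = g x - (if x \<in> S then m else 0)" for x
    have nn: "0 \<le> g' x" if "x \<in> F" for x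
      using that m_le[of x] less.prems(1)[OF that] by (auto simp: g'_def)
    \<comment> \<open>The new function vanishes at \<open>x0\<close>, so the support shrinks
      strictly.\<close>
    have "{x \<in> F. 0 < g' x} \<subset> S"
      using x0 m zero by (auto simp: g'_def S_def split: if_splits)
    then have "card {x \<in> F. 0 < g' x} < card S" using finS by (rule psubset_card_mono[rotated])
    then have IH: "h * (\<Sum>x\<in>F. g' x) \<le> (\<Sum>e\<in>E. \<bar>g' (fst e) - g' (snd e)\<bar>)"
      using less.prems(2) nn by (intro less.hyps) (auto simp: S_def)
    have iso: "h * card S \<le> card {e \<in> E. (fst e \<in> S) \<noteq> (snd e \<in> S)}"
      using isoperimetric[OF False SF] less.prems(2) by (simp add: S_def)
    have "(\<Sum>x\<in>F. g x) = (\<Sum>x\<in>F. g' x + (if x \<in> S then m else 0))"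
      by (simp add: g'_def)
    also have "\<dots> = (\<Sum>x\<in>F. g' x) + m * card S"
      using finite_F SF by (simp add: sum.distrib sum.If_cases Int_absorb1 Int_commute)
    finally have "h * (\<Sum>x\<in>F. g x) = h * (\<Sum>x\<in>F. g' x) + m * (h * card S)"
      by (simp add: algebra_simps)
    also have "\<dots> \<le> (\<Sum>e\<in>E. \<bar>g' (fst e) - g' (snd e)\<bar>) + m * card {e \<in> E. (fst e \<in> S) \<noteq> (snd e \<in> S)}"
      using IH iso m by (intro add_mono mult_left_mono) auto
    also have "\<dots> = (\<Sum>e\<in>E. \<bar>g' (fst e) - g' (snd e)\<bar> + (if (fst e \<in> S) \<noteq> (snd e \<in> S) then m else 0))"
      using finite_E by (simp add: sum.distrib sum.If_cases Collect_conj_eq Int_commute)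
    \<comment> \<open>The layers are nested: an edge with one end in \<open>S\<close> has value 0 at
      the other end and loses exactly \<open>m\<close>; on all other edges the two shifts
      agree.\<close>
    also have "\<dots> = (\<Sum>e\<in>E. \<bar>g (fst e) - g (snd e)\<bar>)"
    proof (intro sum.cong refl)
      fix e assume "e \<in> E"
      then have "fst e \<in> F" "snd e \<in> F" using E_subset by auto
      then show "\<bar>g' (fst e) - g' (snd e)\<bar> + (if (fst e \<in> S) \<noteq> (snd e \<in> S) then m else 0)
          = \<bar>g (fst e) - g (snd e)\<bar>"
        using m_le[of "fst e"] m_le[of "snd e"] zero[of "fst e"] zero[of "snd e"] m
        by (auto simp: g'_def)
    qed
    finally show ?thesis .
  qed
qed

text \<open>This is \<open>2 * p * \<epsilon> powr (1 - p)\<close> for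
  \<open>\<epsilon> = h / (4 * p * D)\<close>, with the power of \<open>h\<close> split off.\<close>

definition poincare_const :: "real \<Rightarrow> real" where
  "poincare_const p = 2 * p * (4 * p * D) powr (p - 1)"

text \<open>Apply \<open>coarea\<close> to \<open>u powr p\<close>, which has the support of
  \<open>u\<close>, and split each edge difference by \<open>abs_powr_diff_le\<close>. The degree
  bounds turn the vertex terms into a multiple of \<open>U\<close> that half of the left side
  absorbs; a factor \<open>h powr (p - 1)\<close> then turns \<open>h\<close> into
  \<open>h powr p\<close>.\<close>

lemma poincare_half_support:
  fixes u :: "'a \<Rightarrow> real"
  assumes "\<And>x. x \<in> F \<Longrightarrow> 0 \<le> u x" "2 * card {x \<in> F. 0 < u x} \<le> card F" and p: "1 \<le> p"
  shows "h powr p * (\<Sum>x\<in>F. u x powr p)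
    \<le> poincare_const p * (\<Sum>e\<in>E. \<bar>u (fst e) - u (snd e)\<bar> powr p)"
proof -
  \<comment> \<open>chosen so that the terms \<open>u\<^sup>p\<close> on the right-hand side of \<open>abs_powr_diff_le\<close> sum to half of the left-hand side\<close>
  define \<epsilon> where "\<epsilon> = h / (4 * p * D)"
  have \<epsilon>: "0 < \<epsilon>" using h_pos D_pos p by (simp add: \<epsilon>_def)
  define U where "U = (\<Sum>x\<in>F. u x powr p)"
  define W where "W = (\<Sum>e\<in>E. \<bar>u (fst e) - u (snd e)\<bar> powr p)"
  have "{x \<in> F. 0 < u x powr p} = {x \<in> F. 0 < u x}" using assms(1) by force
  then have "h * U \<le> (\<Sum>e\<in>E. \<bar>u (fst e) powr p - u (snd e) powr p\<bar>)"
    unfolding U_def using assms by (intro coarea) auto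
  also have "\<dots> \<le> (\<Sum>e\<in>E. p * \<epsilon> * ((\<bar>u (fst e) - u (snd e)\<bar> / \<epsilon>) powr p
      + (u (fst e) powr p + u (snd e) powr p)))"
    using E_subset assms(1) \<epsilon> p by (intro sum_mono abs_powr_diff_le) auto
  also have "\<dots> = p * \<epsilon> * (W / \<epsilon> powr p
      + ((\<Sum>e\<in>E. u (fst e) powr p) + (\<Sum>e\<in>E. u (snd e) powr p)))"
    using \<epsilon> by (simp add: W_def sum.distrib powr_divide flip: sum_distrib_left sum_divide_distrib)
  also have "\<dots> \<le> p * \<epsilon> * (W / \<epsilon> powr p + (D * U + D * U))"
    unfolding U_def using p \<epsilon>
    by (intro mult_left_mono add_mono sum_fst_le[of "\<lambda>x. u x powr p"] sum_snd_le[of "\<lambda>x. u x powr p"]) auto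
  also have "\<dots> = p * \<epsilon> * W / \<epsilon> powr p + h / 2 * U"
    using p D_pos by (simp add: \<epsilon>_def field_simps)
  finally have "h / 2 * U \<le> p * \<epsilon> * W / \<epsilon> powr p" by linarith
  also have "\<dots> = p * W * \<epsilon> powr (1 - p)"
    using \<epsilon> by (simp add: powr_diff)
  also have "\<epsilon> powr (1 - p) = (4 * p * D) powr (p - 1) * h powr (1 - p)"
    using h_pos D_pos p by (simp add: \<epsilon>_def powr_divide powr_diff)
  finally have "h * U \<le> poincare_const p * W * h powr (1 - p)"
    by (simp add: poincare_const_def mult_ac)
  then have "h powr (p - 1) * (h * U) \<le> h powr (p - 1) * (poincare_const p * W * h powr (1 - p))"
    by (intro mult_left_mono) auto
  moreover have "h powr (p - 1) * h = h powr p" "h powr (p - 1) * h powr (1 - p) = 1"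
    using h_pos by (simp_all add: powr_diff)
  ultimately have "h powr p * U \<le> poincare_const p * W"
    by (metis mult.assoc mult.commute mult_1)
  then show ?thesis by (simp add: U_def W_def)
qed

text \<open>The positive and negative parts of \<open>f - m\<close> at a median \<open>m\<close> are
  each supported on at most half of \<open>F\<close>. Truncation does not increase edge differences,
  and at each point at most one part is nonzero, so the \<open>p\<close>-th powers add up.\<close>

lemma poincare_median:
  fixes f :: "'a \<Rightarrow> real"
  assumes p: "1 \<le> p"
  obtains m where "h powr p * (\<Sum>x\<in>F. \<bar>f x - m\<bar> powr p)
    \<le> 2 * poincare_const p * (\<Sum>e\<in>E. \<bar>f (fst e) - f (snd e)\<bar> powr p)"
proof -
  obtain m where m: "2 * card {x \<in> F. m < f x} \<le> card F" "2 * card {x \<in> F. f x < m} \<le> card F"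
    using median_exists[OF finite_F] by metis
  have C: "0 \<le> poincare_const p" using p by (simp add: poincare_const_def)
  let ?W = "\<Sum>e\<in>E. \<bar>f (fst e) - f (snd e)\<bar> powr p"
  have part: "h powr p * (\<Sum>x\<in>F. u x powr p) \<le> poincare_const p * ?W"
    if u: "\<And>x. 0 \<le> u x" "2 * card {x \<in> F. 0 < u x} \<le> card F"
      "\<And>x y. \<bar>u x - u y\<bar> \<le> \<bar>f x - f y\<bar>" for u :: "'a \<Rightarrow> real"
  proof -
    have "h powr p * (\<Sum>x\<in>F. u x powr p)
        \<le> poincare_const p * (\<Sum>e\<in>E. \<bar>u (fst e) - u (snd e)\<bar> powr p)"
      using u p by (intro poincare_half_support) auto
    also have "\<dots> \<le> poincare_const p * ?W"
      using C p u by (intro mult_left_mono sum_mono powr_mono2) auto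
    finally show ?thesis .
  qed
  have "\<bar>f x - m\<bar> powr p = max (f x - m) 0 powr p + max (m - f x) 0 powr p" for x
    using p by (auto simp: max_def)
  then have "h powr p * (\<Sum>x\<in>F. \<bar>f x - m\<bar> powr p)
      = h powr p * (\<Sum>x\<in>F. max (f x - m) 0 powr p) + h powr p * (\<Sum>x\<in>F. max (m - f x) 0 powr p)"
    by (simp add: sum.distrib distrib_left)
  also have "\<dots> \<le> poincare_const p * ?W + poincare_const p * ?W"
    using m by (intro add_mono part) (simp_all add: less_max_iff_disj)
  finally show ?thesis using that[of m] by simp
qed

text \<open>The triangle inequality through the median gives a form in which the median no longer
  appears. This matters for maps into \<open>L^p\<close>, where the median would depend on the point
  of the measure space.\<close>

lemma poincare:
  fixes f :: "'a \<Rightarrow> real"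
  assumes p: "1 \<le> p"
  shows "h powr p * (\<Sum>x\<in>F. \<Sum>y\<in>F. \<bar>f x - f y\<bar> powr p)
    \<le> 4 * 2 powr p * card F * poincare_const p * (\<Sum>e\<in>E. \<bar>f (fst e) - f (snd e)\<bar> powr p)"
proof -
  obtain m where m: "h powr p * (\<Sum>x\<in>F. \<bar>f x - m\<bar> powr p)
      \<le> 2 * poincare_const p * (\<Sum>e\<in>E. \<bar>f (fst e) - f (snd e)\<bar> powr p)"
    by (rule poincare_median[OF p])
  have "\<bar>f x - f y\<bar> powr p \<le> 2 powr p * (\<bar>f x - m\<bar> powr p + \<bar>f y - m\<bar> powr p)" for x y
  proof -
    have "\<bar>f x - f y\<bar> powr p \<le> (\<bar>f x - m\<bar> + \<bar>f y - m\<bar>) powr p"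
      using p by (intro powr_mono2) auto
    also have "\<dots> \<le> 2 powr p * (\<bar>f x - m\<bar> powr p + \<bar>f y - m\<bar> powr p)"
      using p by (intro powr_add_le) auto
    finally show ?thesis .
  qed
  then have "(\<Sum>x\<in>F. \<Sum>y\<in>F. \<bar>f x - f y\<bar> powr p)
      \<le> (\<Sum>x\<in>F. \<Sum>y\<in>F. 2 powr p * (\<bar>f x - m\<bar> powr p + \<bar>f y - m\<bar> powr p))"
    by (intro sum_mono)
  also have "\<dots> = 2 powr p * (2 * card F * (\<Sum>x\<in>F. \<bar>f x - m\<bar> powr p))"
    by (simp add: sum.distrib sum_distrib_left[symmetric])
  finally have "h powr p * (\<Sum>x\<in>F. \<Sum>y\<in>F. \<bar>f x - f y\<bar> powr p)
      \<le> h powr p * (2 powr p * (2 * card F * (\<Sum>x\<in>F. \<bar>f x - m\<bar> powr p)))"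
    by (intro mult_left_mono) auto
  also have "\<dots> = 2 powr p * 2 * card F * (h powr p * (\<Sum>x\<in>F. \<bar>f x - m\<bar> powr p))"
    by (simp add: mult_ac)
  also have "\<dots> \<le> 2 powr p * 2 * card F *
      (2 * poincare_const p * (\<Sum>e\<in>E. \<bar>f (fst e) - f (snd e)\<bar> powr p))"
    by (intro mult_left_mono m) auto
  finally show ?thesis by (simp add: mult_ac)
qed

end

subsection \<open>Distances and Cheeger constants in bounded degree graphs\<close>

locale connected_bounded_graph = pair_wf_digraph G for G :: "'a pair_pre_digraph" +
  fixes D :: nat
  assumes infinite_verts: "infinite (pverts G)"
    and connected: "Digraph_Component.connected (with_proj G)"
    and finite_neighbours: "\<And>v. v \<in> pverts G \<Longrightarrow> finite {u. v \<rightarrow>\<^bsub>mk_symmetric G\<^esub> u}"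
    and card_neighbours: "\<And>v. v \<in> pverts G \<Longrightarrow> card {u. v \<rightarrow>\<^bsub>mk_symmetric G\<^esub> u} \<le> D"
    and degree_pos: "0 < D"
begin

sublocale S: pair_wf_digraph "mk_symmetric G"
  by (rule wellformed_mk_symmetric)

section \<open>Walks, distances and the growth of balls\<close>

lemma graph_dist_le: "S.awalk x w y \<Longrightarrow> graph_dist G x y \<le> length w"
  unfolding graph_dist_def by (rule Least_le) blast

lemma shortest_walk:
  assumes "x \<in> pverts G" "y \<in> pverts G"
  obtains w where "S.awalk x w y" "length w = graph_dist G x y"
proof -
  have "x \<rightarrow>\<^sup>*\<^bsub>mk_symmetric G\<^esub> y"
    using connected assms by (simp add: connected_def strongly_connected_def)
  then have "\<exists>n w. S.awalk x w y \<and> length w = n"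
    by (simp add: S.reachable_awalk)
  then have "\<exists>w. S.awalk x w y \<and> length w = graph_dist G x y"
    unfolding graph_dist_def by (rule LeastI_ex)
  then show ?thesis using that by blast
qed

lemma graph_dist_edge: "(x, y) \<in> parcs (mk_symmetric G) \<Longrightarrow> graph_dist G x y \<le> 1"
  using graph_dist_le[of x "[(x, y)]" y] S.in_arcsD2[of x y] by (simp add: S.awalk_simps)

text \<open>Drop the last edge of a shortest walk. If its start were closer to \<open>x\<close> than
  \<open>n\<close>, appending that edge would give too short a walk to \<open>y\<close>.\<close>

lemma graph_dist_SucE:
  assumes "x \<in> pverts G" "y \<in> pverts G" "graph_dist G x y = Suc n"
  obtains z where "z \<in> pverts G" "graph_dist G x z = n" "z \<rightarrow>\<^bsub>mk_symmetric G\<^esub> y"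
proof -
  obtain w where w: "S.awalk x w y" "length w = Suc n"
    using shortest_walk[OF assms(1,2)] assms(3) by metis
  then obtain w' e where we: "w = w' @ [e]" by (metis length_Suc_conv_rev)
  then have wz: "S.awalk x w' (fst e)" "e \<in> parcs (mk_symmetric G)" "snd e = y"
    using w(1) by (auto simp: S.awalk_append_iff S.awalk_simps)
  have z: "fst e \<in> pverts G" using S.arc_fst_in_verts[OF wz(2)] by simp
  have le: "graph_dist G x (fst e) \<le> n" using graph_dist_le[OF wz(1)] w(2) we by simp
  obtain v where v: "S.awalk x v (fst e)" "length v = graph_dist G x (fst e)"
    using shortest_walk[OF assms(1) z] .
  have "S.awalk (fst e) [e] y"
    using wz z S.arc_snd_in_verts[OF wz(2)] by (auto simp: S.awalk_simps)
  then have "graph_dist G x y \<le> length (v @ [e])"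
    using v(1) by (intro graph_dist_le) (rule S.awalk_appendI)
  with v(2) assms(3) le have "graph_dist G x (fst e) = n" by simp
  then show ?thesis using that[of "fst e"] z wz by (metis prod.collapse with_proj_simps(3))
qed

text \<open>Each vertex of the next ball is in the old ball or adjacent to it, and a vertex with its
  neighbours makes at most \<open>D + 1\<close> vertices.\<close>

lemma card_ball_le:
  assumes "x \<in> pverts G"
  shows "finite {y \<in> pverts G. graph_dist G x y \<le> r} \<and>
    card {y \<in> pverts G. graph_dist G x y \<le> r} \<le> (D + 1) ^ r"
proof (induction r)
  case 0
  have "y = x" if y: "y \<in> pverts G" "graph_dist G x y = 0" for y
    using shortest_walk[OF assms y(1)] y(2) by (metis S.awalk_Nil_iff length_0_conv)
  then have "{y \<in> pverts G. graph_dist G x y \<le> 0} \<subseteq> {x}" by auto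
  then show ?case
    by (metis (no_types, lifting) card_mono finite.emptyI finite_insert is_singletonI
        is_singleton_altdef power_0 finite_subset)
next
  case (Suc r)
  define B where "B = {y \<in> pverts G. graph_dist G x y \<le> r}"
  define N where "N z = insert z {u. z \<rightarrow>\<^bsub>mk_symmetric G\<^esub> u}" for z
  have B: "finite B" "card B \<le> (D + 1) ^ r" "B \<subseteq> pverts G"
    using Suc by (auto simp: B_def)
  have N: "finite (N z)" "card (N z) \<le> D + 1" if "z \<in> B" for z
  proof -
    have z: "z \<in> pverts G" using that B by auto
    show "finite (N z)" using finite_neighbours[OF z] by (simp add: N_def)
    show "card (N z) \<le> D + 1"
      using card_neighbours[OF z] card_insert_le_m1[of "D + 1" "{u. z \<rightarrow>\<^bsub>mk_symmetric G\<^esub> u}" z]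
      by (simp add: N_def)
  qed
  have "{y \<in> pverts G. graph_dist G x y \<le> Suc r} \<subseteq> (\<Union>z\<in>B. N z)"
  proof
    fix y assume y: "y \<in> {y \<in> pverts G. graph_dist G x y \<le> Suc r}"
    show "y \<in> (\<Union>z\<in>B. N z)"
    proof (cases "graph_dist G x y \<le> r")
      case True
      then show ?thesis using y by (auto simp: B_def N_def)
    next
      case False
      then have "graph_dist G x y = Suc r" using y by simp
      then obtain z where "z \<in> pverts G" "graph_dist G x z = r" "z \<rightarrow>\<^bsub>mk_symmetric G\<^esub> y"
        using graph_dist_SucE assms y by blast
      then show ?thesis by (auto simp: B_def N_def)
    qed
  qed
  moreover have "finite (\<Union>z\<in>B. N z)" using B N by blast
  moreover have "card (\<Union>z\<in>B. N z) \<le> (D + 1) ^ Suc r"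
  proof -
    have "card (\<Union>z\<in>B. N z) \<le> (\<Sum>z\<in>B. card (N z))" using B by (intro card_UN_le)
    also have "\<dots> \<le> card B * (D + 1)" using sum_bounded_above[of B "\<lambda>z. card (N z)" "D + 1"] N by simp
    also have "\<dots> \<le> (D + 1) ^ r * (D + 1)" using B by (intro mult_right_mono) auto
    finally show ?thesis by (simp add: mult.commute)
  qed
  ultimately show ?case by (meson card_mono finite_subset order_trans)
qed

text \<open>Balls are finite and the graph is infinite, so some vertex is at distance at least
  \<open>n\<close>; stepping back along shortest walks lowers the distance by one each time. Hence
  every distance is realised and the largest compression function is well defined.\<close>

lemma ex_graph_dist:
  assumes "x \<in> pverts G"
  shows "\<exists>y \<in> pverts G. graph_dist G x y = n"
proof -
  have "\<not> pverts G \<subseteq> {y \<in> pverts G. graph_dist G x y \<le> n}"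
    using infinite_verts card_ball_le[OF assms, of n] finite_subset by blast
  then obtain y where "y \<in> pverts G" "\<not> graph_dist G x y \<le> n" by blast
  then have y: "y \<in> pverts G" "n \<le> graph_dist G x y" by simp_all
  have "\<exists>y \<in> pverts G. graph_dist G x y = n" if "y \<in> pverts G" "n \<le> m" "graph_dist G x y = m" for y m
    using that(2,1,3)
  proof (induction m arbitrary: y rule: dec_induct)
    case base
    then show ?case by blast
  next
    case (step m)
    then show ?case using graph_dist_SucE[OF assms] by metis
  qed
  with y show ?thesis by blast
qed

section \<open>Degrees and Cheeger constants of induced subgraphs\<close>

lemma arcs_symmetric:
  "(x, y) \<in> parcs G \<Longrightarrow> x \<rightarrow>\<^bsub>mk_symmetric G\<^esub> y"
  "(x, y) \<in> parcs G \<Longrightarrow> y \<rightarrow>\<^bsub>mk_symmetric G\<^esub> x"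
  by (auto simp: parcs_mk_symmetric intro!: bexI[of _ "(x, y)"])

lemma degree_le:
  assumes "x \<in> pverts G"
  shows "card {y. (x, y) \<in> parcs G \<inter> F \<times> F} \<le> D" "card {y. (y, x) \<in> parcs G \<inter> F \<times> F} \<le> D"
proof -
  have *: "card A \<le> D" if "A \<subseteq> {u. x \<rightarrow>\<^bsub>mk_symmetric G\<^esub> u}" for A
    by (rule order_trans[OF card_mono[OF finite_neighbours[OF assms] that] card_neighbours[OF assms]])
  show "card {y. (x, y) \<in> parcs G \<inter> F \<times> F} \<le> D"
    by (rule *) (use arcs_symmetric(1) in blast)
  show "card {y. (y, x) \<in> parcs G \<inter> F \<times> F} \<le> D"
    by (rule *) (use arcs_symmetric(2) in blast)
qed

lemma cheeger_on_le:
  assumes F: "finite F" "2 \<le> card F" and A: "A \<noteq> {}" "A \<subseteq> F" "2 * card A \<le> card F"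
  shows "cheeger_on G F * card A
    \<le> card {e \<in> parcs G \<inter> F \<times> F. (fst e \<in> A) \<noteq> (snd e \<in> A)}"
proof -
  define \<B> where "\<B> A = {e \<in> parcs G \<inter> F \<times> F. (fst e \<in> A) \<noteq> (snd e \<in> A)}" for A
  have bd: "edge_boundary (with_proj G \<restriction> F) A = \<B> A" for A
    by (auto simp: edge_boundary_def \<B>_def induce_subgraph_def)
  define Q where "Q = {real (card (\<B> A)) / real (card A) | A.
     A \<noteq> {} \<and> A \<subseteq> F \<and> real (card A) \<le> real (card F) / 2}"
  \<comment> \<open>\<open>Min\<close> bounds its set from below only when the set is finite; here
    the quotients are indexed by subsets of \<open>F\<close>.\<close>
  have "Q \<subseteq> (\<lambda>A. real (card (\<B> A)) / real (card A)) ` Pow F" by (auto simp: Q_def)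
  then have "finite Q" by (rule finite_subset) (intro finite_imageI finite_Pow_iff[THEN iffD2] F)
  moreover have "real (card (\<B> A)) / real (card A) \<in> Q"
    unfolding Q_def using A by (intro CollectI exI[of _ A] conjI refl) simp_all
  ultimately have "Min Q \<le> real (card (\<B> A)) / real (card A)" by simp
  moreover have "cheeger_on G F = Min Q"
    using F by (simp add: cheeger_on_def cheeger_def bd Q_def)
  moreover have "0 < card A" using A F by (simp add: card_gt_0_iff finite_subset)
  ultimately show ?thesis by (simp add: \<B>_def pos_le_divide_eq)
qed

text \<open>Test the Cheeger constant on a singleton. The factor 2 allows for both orientations of
  an edge.\<close>

lemma cheeger_on_le_degree:
  assumes "F \<subseteq> pverts G" "finite F"
  shows "cheeger_on G F \<le> 2 * D"
proof (cases "2 \<le> card F")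
  case True
  then obtain x where x: "x \<in> F" by fastforce
  then have xV: "x \<in> pverts G" using assms by auto
  let ?N = "{u. x \<rightarrow>\<^bsub>mk_symmetric G\<^esub> u}"
  have "{e \<in> parcs G \<inter> F \<times> F. (fst e \<in> {x}) \<noteq> (snd e \<in> {x})} \<subseteq> Pair x ` ?N \<union> (\<lambda>y. (y, x)) ` ?N"
    using arcs_symmetric by auto
  then have "card {e \<in> parcs G \<inter> F \<times> F. (fst e \<in> {x}) \<noteq> (snd e \<in> {x})}
      \<le> card (Pair x ` ?N \<union> (\<lambda>y. (y, x)) ` ?N)"
    using finite_neighbours[OF xV] by (intro card_mono) auto
  also have "\<dots> \<le> card (Pair x ` ?N) + card ((\<lambda>y. (y, x)) ` ?N)" by (rule card_Un_le)
  also have "\<dots> \<le> card ?N + card ?N"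
    using finite_neighbours[OF xV] by (intro add_mono card_image_le)
  also have "\<dots> \<le> 2 * D" using card_neighbours[OF xV] by simp
  finally show ?thesis using cheeger_on_le[of F "{x}"] True x assms by simp
qed (simp add: cheeger_on_def)

lemma finite_isoperimetric_induced:
  assumes "F \<subseteq> pverts G" "finite F" "2 \<le> card F" "0 < cheeger_on G F"
  shows "finite_isoperimetric F (parcs G \<inter> F \<times> F) (cheeger_on G F) D"
proof
  show "0 < real D" using degree_pos by simp
  show "real (card {y. (x, y) \<in> parcs G \<inter> F \<times> F}) \<le> real D" if "x \<in> F" for x
    unfolding of_nat_le_iff using assms(1) that by (intro degree_le(1)) blast
  show "real (card {y. (y, x) \<in> parcs G \<inter> F \<times> F}) \<le> real D" if "x \<in> F" for x
    unfolding of_nat_le_iff using assms(1) that by (intro degree_le(2)) blast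
  show "cheeger_on G F * card A \<le> card {e \<in> parcs G \<inter> F \<times> F. (fst e \<in> A) \<noteq> (snd e \<in> A)}"
    if "A \<noteq> {}" "A \<subseteq> F" "2 * card A \<le> card F" for A
    using cheeger_on_le[OF assms(2,3) that] .
  show "finite F" "0 < cheeger_on G F" by fact+
  show "parcs G \<inter> F \<times> F \<subseteq> F \<times> F" by (rule Int_lower2)
qed

text \<open>The hypothesis involves \<open>ln (card F)\<close>, the conclusion \<open>ln N\<close>,
  and \<open>F\<close> may be much smaller than \<open>N\<close>. The cut is at
  \<open>card F = sqrt N\<close>: below it the degree bound suffices, above it the two logarithms
  agree up to a factor 2.\<close>

lemma Sep_le:
  fixes c K :: real
  assumes h: "\<And>F. F \<subseteq> pverts G \<Longrightarrow> finite F \<Longrightarrow> 2 \<le> card F \<Longrightarrow>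
      cheeger_on G F * ln (card F) powr c \<le> K"
    and c: "0 < c" "c \<le> 1" and K: "0 \<le> K" and N: "2 \<le> N"
  shows "Sep G N / N \<le> (4 * D + 2 * K) / ln N powr c"
proof -
  have lnN: "0 < ln (real N)" using N by simp
  have "card F * cheeger_on G F \<le> (4 * D + 2 * K) * N / ln N powr c"
    if F: "F \<subseteq> pverts G" "finite F" "card F \<le> N" for F
  proof (cases "2 \<le> card F \<and> 0 \<le> cheeger_on G F")
    \<comment> \<open>Either \<open>F\<close> has at most one vertex, where the constant is 0 by
      convention, or the constant is negative; the left side is then at most 0.\<close>
    case False
    then have "card F * cheeger_on G F \<le> 0"
      by (auto simp: cheeger_on_def mult_le_0_iff)
    also have "0 \<le> (4 * D + 2 * K) * N / ln N powr c" using K by simp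
    finally show ?thesis .
  next
    case True
    define n where "n = real (card F)"
    have n: "2 \<le> n" "n \<le> N" using True F by (auto simp: n_def)
    have hp: "0 \<le> cheeger_on G F" using True by auto
    have "n * cheeger_on G F * ln N powr c \<le> (4 * D + 2 * K) * N"
    proof (cases "n\<^sup>2 \<le> N")
      case small: True
      then have nsq: "n \<le> sqrt N" using n by (simp add: real_le_rsqrt)
      have "ln N = 2 * ln (sqrt N)" using N by (simp add: ln_sqrt)
      also have "\<dots> < 2 * sqrt N" using N ln_less_self[of "sqrt N"] by (simp del: ln_sqrt)
      finally have "ln N \<le> 2 * sqrt N" by simp
      then have "ln N powr c \<le> (2 * sqrt N) powr c" using lnN c by (intro powr_mono2) auto
      also have "\<dots> \<le> (2 * sqrt N) powr 1"
      proof (intro powr_mono)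
        have "1 \<le> sqrt N" using N by simp
        then show "1 \<le> 2 * sqrt N" by linarith
      qed (use c in simp)
      finally have lnc: "ln N powr c \<le> 2 * sqrt N" using N by simp
      have "n * cheeger_on G F * ln N powr c \<le> sqrt N * (2 * D) * (2 * sqrt N)"
        using nsq lnc cheeger_on_le_degree[OF F(1,2)] hp n by (intro mult_mono) auto
      also have "\<dots> = 4 * real D * (sqrt N * sqrt N)" by (simp only: mult_ac) simp
      also have "\<dots> \<le> (4 * D + 2 * K) * N" using K by (simp add: distrib_right)
      finally show ?thesis .
    next
      case False
      then have "ln N \<le> ln (n\<^sup>2)" using N by (intro ln_mono) linarith+
      also have "\<dots> = 2 * ln n" using n ln_realpow[of n 2] by simp
      finally have "ln N powr c \<le> (2 * ln n) powr c" using lnN c by (intro powr_mono2) auto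
      also have "\<dots> = 2 powr c * ln n powr c" using n by (simp add: powr_mult)
      also have "\<dots> \<le> 2 powr 1 * ln n powr c" using c by (intro mult_right_mono powr_mono) auto
      finally have lnc: "ln N powr c \<le> 2 * ln n powr c" by simp
      have "n * cheeger_on G F * ln N powr c \<le> N * (cheeger_on G F * (2 * ln n powr c))"
        unfolding mult.assoc using n hp lnc by (intro mult_mono) auto
      also have "\<dots> = N * (2 * (cheeger_on G F * ln n powr c))" by simp
      also have "\<dots> \<le> N * (2 * K)"
        using h[OF F(1,2)] True by (intro mult_left_mono) (auto simp: n_def)
      also have "\<dots> \<le> (4 * D + 2 * K) * N" by (simp add: algebra_simps)
      finally show ?thesis .
    qed
    then show ?thesis using lnN by (simp add: n_def pos_le_divide_eq)
  qed
  \<comment> \<open>The empty set belongs to the index set, so a uniform upper bound also bounds the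
    real supremum.\<close>
  then have "Sep G N \<le> (4 * D + 2 * K) * N / ln N powr c"
    unfolding Sep_def by (intro cSUP_least) auto
  then show ?thesis using N by (simp add: pos_divide_le_eq)
qed

end

subsection \<open>Compression of embeddings into $L^p$\<close>

lemma Lp_dist_nonneg: "0 \<le> Lp_dist p M f g"
  by (simp add: Lp_dist_def Lp_norm_def)

lemma bdd_below_Lp_dist: "bdd_below ((\<lambda>(x, y). Lp_dist p M (\<Phi> x) (\<Phi> y)) ` A)"
  by (intro bdd_belowI[of _ 0]) (auto simp: Lp_dist_nonneg)

lemma integrable_powr_diff:
  assumes "f \<in> Lp_space p M" "g \<in> Lp_space p M" "0 \<le> p"
  shows "integrable M (\<lambda>t. \<bar>f t - g t\<bar> powr p)"
proof (rule Bochner_Integration.integrable_bound)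
  show "integrable M (\<lambda>t. 2 powr p * (\<bar>f t\<bar> powr p + \<bar>g t\<bar> powr p))"
    using assms by (auto simp: Lp_space_def)
  show "(\<lambda>t. \<bar>f t - g t\<bar> powr p) \<in> borel_measurable M"
    using assms by (auto simp: Lp_space_def)
  have "\<bar>f t - g t\<bar> powr p \<le> 2 powr p * (\<bar>f t\<bar> powr p + \<bar>g t\<bar> powr p)" for t
  proof -
    have "\<bar>f t - g t\<bar> powr p \<le> (\<bar>f t\<bar> + \<bar>g t\<bar>) powr p"
      using assms by (intro powr_mono2) auto
    also have "\<dots> \<le> 2 powr p * (\<bar>f t\<bar> powr p + \<bar>g t\<bar> powr p)"
      using assms by (intro powr_add_le) auto
    finally show ?thesis .
  qed
  then show "AE t in M. norm (\<bar>f t - g t\<bar> powr p) \<le> norm (2 powr p * (\<bar>f t\<bar> powr p + \<bar>g t\<bar> powr p))"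
    by (intro AE_I2) (simp add: abs_mult)
qed

lemma Lp_dist_powr:
  assumes "0 < p"
  shows "Lp_dist p M f g powr p = (\<integral>t. \<bar>f t - g t\<bar> powr p \<partial>M)"
  using assms by (simp add: Lp_dist_def Lp_norm_def powr_powr Bochner_Integration.integral_nonneg)

text \<open>Integrate \<open>poincare\<close> for the functions
  \<open>\<lambda>x. \<Phi> x t\<close> over \<open>t\<close>; the constant does not depend on
  \<open>t\<close>, and the finite sums commute with the integral.\<close>

lemma (in finite_isoperimetric) Lp_poincare:
  assumes p: "1 \<le> p" and \<Phi>: "\<And>x. x \<in> F \<Longrightarrow> \<Phi> x \<in> Lp_space p M"
  shows "h powr p * (\<Sum>x\<in>F. \<Sum>y\<in>F. Lp_dist p M (\<Phi> x) (\<Phi> y) powr p)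
    \<le> 4 * 2 powr p * card F * poincare_const p
        * (\<Sum>e\<in>E. Lp_dist p M (\<Phi> (fst e)) (\<Phi> (snd e)) powr p)"
proof -
  have int: "integrable M (\<lambda>t. \<bar>\<Phi> x t - \<Phi> y t\<bar> powr p)" if "x \<in> F" "y \<in> F" for x y
    using that p by (intro integrable_powr_diff \<Phi>) auto
  have intE: "integrable M (\<lambda>t. \<bar>\<Phi> (fst e) t - \<Phi> (snd e) t\<bar> powr p)" if "e \<in> E" for e
    using that E_subset by (intro int) auto
  have "h powr p * (\<Sum>x\<in>F. \<Sum>y\<in>F. Lp_dist p M (\<Phi> x) (\<Phi> y) powr p)
      = (\<integral>t. h powr p * (\<Sum>x\<in>F. \<Sum>y\<in>F. \<bar>\<Phi> x t - \<Phi> y t\<bar> powr p) \<partial>M)"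
    using p int by (simp add: Lp_dist_powr integral_sum)
  also have "\<dots> \<le> (\<integral>t. 4 * 2 powr p * card F * poincare_const p
      * (\<Sum>e\<in>E. \<bar>\<Phi> (fst e) t - \<Phi> (snd e) t\<bar> powr p) \<partial>M)"
  proof (rule integral_mono)
    show "integrable M (\<lambda>t. h powr p * (\<Sum>x\<in>F. \<Sum>y\<in>F. \<bar>\<Phi> x t - \<Phi> y t\<bar> powr p))"
      by (intro integrable_mult_right Bochner_Integration.integrable_sum int)
    show "integrable M (\<lambda>t. 4 * 2 powr p * card F * poincare_const p
        * (\<Sum>e\<in>E. \<bar>\<Phi> (fst e) t - \<Phi> (snd e) t\<bar> powr p))"
      by (intro integrable_mult_right Bochner_Integration.integrable_sum intE)
  qed (rule poincare[OF p])
  also have "\<dots> = 4 * 2 powr p * card F * poincare_const p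
        * (\<Sum>e\<in>E. Lp_dist p M (\<Phi> (fst e)) (\<Phi> (snd e)) powr p)"
    using p intE by (simp add: Lp_dist_powr integral_sum)
  finally show ?thesis .
qed

locale graph_embedding = connected_bounded_graph G D
  for G :: "'a pair_pre_digraph" and D +
  fixes p :: real and M :: "'b measure" and \<Phi> :: "'a \<Rightarrow> 'b \<Rightarrow> real"
  assumes p: "1 \<le> p" and embedding: "lipschitz_embedding p G M \<Phi>"
begin

section \<open>The largest compression function and its exponent\<close>

abbreviation "pairs_at_dist n \<equiv> {(x, y). x \<in> pverts G \<and> y \<in> pverts G \<and> graph_dist G x y = n}"

abbreviation "\<rho> \<equiv> largest_compression p G M \<Phi>"

lemma lipschitz:
  "x \<in> pverts G \<Longrightarrow> y \<in> pverts G \<Longrightarrow> Lp_dist p M (\<Phi> x) (\<Phi> y) \<le> graph_dist G x y"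
  using embedding by (simp add: lipschitz_embedding_def)

text \<open>The constraints at different distances are independent, so the greatest solution is a
  pointwise infimum. Nonemptiness from \<open>ex_graph_dist\<close> makes this real infimum dominate
  every other compression function.\<close>

lemma largest_compression_eq:
  "\<rho> = (\<lambda>n. INF (x, y) \<in> pairs_at_dist n. Lp_dist p M (\<Phi> x) (\<Phi> y))"
  unfolding largest_compression_def
proof (rule Greatest_equality)
  show "compression_function p G M \<Phi> (\<lambda>n. INF (x, y) \<in> pairs_at_dist n. Lp_dist p M (\<Phi> x) (\<Phi> y))"
    unfolding compression_function_def using bdd_below_Lp_dist
    by (intro ballI cINF_lower2[where x = "(x, y)" for x y]) auto
next
  fix \<sigma> assume \<sigma>: "compression_function p G M \<Phi> \<sigma>"
  obtain x where x: "x \<in> pverts G" using infinite_verts by (metis ex_in_conv finite.emptyI)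
  show "\<sigma> \<le> (\<lambda>n. INF (x, y) \<in> pairs_at_dist n. Lp_dist p M (\<Phi> x) (\<Phi> y))"
  proof (rule le_funI, rule cINF_greatest)
    fix n
    obtain y where "y \<in> pverts G" "graph_dist G x y = n" using ex_graph_dist[OF x] by blast
    with x show "pairs_at_dist n \<noteq> {}" by blast
  qed (use \<sigma> in \<open>auto simp: compression_function_def\<close>)
qed

lemma largest_compression_le:
  assumes "x \<in> pverts G" "y \<in> pverts G"
  shows "\<rho> (graph_dist G x y) \<le> Lp_dist p M (\<Phi> x) (\<Phi> y)"
proof -
  show ?thesis
    unfolding largest_compression_eq using assms bdd_below_Lp_dist by (intro cINF_lower2[where x = "(x, y)"]) auto
qed

lemma largest_compression_le_self: "\<rho> n \<le> n"
proof -
  obtain x where x: "x \<in> pverts G" using infinite_verts by (metis ex_in_conv finite.emptyI)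
  obtain y where y: "y \<in> pverts G" "graph_dist G x y = n" using ex_graph_dist[OF x] by blast
  show ?thesis using largest_compression_le[OF x y(1)] lipschitz[OF x y(1)] y(2) by simp
qed

lemma map_compression_exponent_le_1: "map_compression_exponent p G M \<Phi> \<le> 1"
  unfolding map_compression_exponent_def
proof (rule Liminf_le)
  show "\<forall>\<^sub>F n in sequentially. eln (\<rho> n) / eln (real n) \<le> 1"
    using eventually_ge_at_top[of 2]
  proof eventually_elim
    case (elim n)
    have l: "0 < ln (real n)" using elim by simp
    show ?case
    proof (cases "\<rho> n \<le> 0")
      \<comment> \<open>Here \<open>eln\<close> is minus infinity, and dividing by the positive
        \<open>eln (real n)\<close> keeps it there.\<close>
      case True
      then show ?thesis using l elim by (simp add: eln_def)
    next
      case False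
      then have "ln (\<rho> n) \<le> ln n" using largest_compression_le_self[of n] by simp
      then show ?thesis using False l elim by (simp add: eln_def one_ereal_def)
    qed
  qed
qed simp

lemma largest_compression_ge_powr:
  assumes "ereal c < map_compression_exponent p G M \<Phi>"
  shows "\<forall>\<^sub>F n in sequentially. real n powr c \<le> \<rho> n"
proof -
  have "\<forall>\<^sub>F n in sequentially. ereal c < eln (\<rho> n) / eln (real n)"
    using assms unfolding map_compression_exponent_def by (rule less_LiminfD)
  with eventually_ge_at_top[of 2] show ?thesis
  proof eventually_elim
    case (elim n)
    have l: "0 < ln (real n)" using elim by simp
    \<comment> \<open>A nonpositive value would make the quotient minus infinity, contradicting the
      lower bound \<open>c\<close>.\<close>
    have pos: "0 < \<rho> n"
    proof (rule ccontr)
      assume "\<not> ?thesis"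
      then show False using elim l by (simp add: eln_def)
    qed
    with elim l have "c < ln (\<rho> n) / ln n" by (simp add: eln_def)
    then have "c * ln n < ln (\<rho> n)" using l by (simp add: pos_less_divide_eq)
    then have "exp (c * ln n) < exp (ln (\<rho> n))" by simp
    then show ?case using pos elim by (simp add: powr_def)
  qed
qed

text \<open>The sum of \<open>p\<close>-th powers of image distances over pairs in \<open>F\<close>
  is estimated twice. From above, \<open>Lp_poincare\<close> uses that there are at most
  \<open>D * n\<close> edges, each with image length at most 1; from below, at least half of
  \<open>F\<close> is at distance \<open>r\<close> or more from any given point.\<close>

lemma cheeger_on_powr_bound:
  assumes F: "F \<subseteq> pverts G" "finite F" "2 \<le> card F" and h: "0 < cheeger_on G F"
    and r: "2 * (D + 1) ^ r \<le> card F" and c: "0 \<le> c"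
    and \<rho>: "\<And>n. r \<le> n \<Longrightarrow> real n powr c \<le> \<rho> n"
  shows "(cheeger_on G F * real r powr c) powr p
    \<le> 16 * 2 powr p * D * (p * (4 * p * D) powr (p - 1))"
proof -
  interpret P: finite_isoperimetric F "parcs G \<inter> F \<times> F" "cheeger_on G F" D
    using F h by (rule finite_isoperimetric_induced)
  define n where "n = real (card F)"
  have n: "0 < n" using F by (simp add: n_def)
  have C: "0 \<le> P.poincare_const p" using p by (simp add: P.poincare_const_def)
  let ?d = "\<lambda>x y. Lp_dist p M (\<Phi> x) (\<Phi> y) powr p"
  have edge: "?d (fst e) (snd e) \<le> 1" if e: "e \<in> parcs G \<inter> F \<times> F" for e
  proof -
    have v: "fst e \<in> pverts G" "snd e \<in> pverts G" using e F by auto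
    have "graph_dist G (fst e) (snd e) \<le> 1"
      using e arcs_symmetric(1)[of "fst e" "snd e"] by (intro graph_dist_edge) simp
    then have "Lp_dist p M (\<Phi> (fst e)) (\<Phi> (snd e)) \<le> 1"
      using lipschitz[OF v] by linarith
    then show ?thesis using powr_mono2[of p _ 1] p by (simp add: Lp_dist_nonneg)
  qed
  have "(\<Sum>e\<in>parcs G \<inter> F \<times> F. ?d (fst e) (snd e)) \<le> (\<Sum>e\<in>parcs G \<inter> F \<times> F. 1)"
    by (intro sum_mono edge)
  also have "\<dots> \<le> D * n" using P.sum_fst_le[of "\<lambda>_. 1"] by (simp add: n_def)
  finally have E: "(\<Sum>e\<in>parcs G \<inter> F \<times> F. ?d (fst e) (snd e)) \<le> D * n" .
  have far: "n / 2 * (real r powr c) powr p \<le> (\<Sum>y\<in>F. ?d x y)" if x: "x \<in> F" for x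
  proof -
    have xV: "x \<in> pverts G" using x F by auto
    let ?B = "{y \<in> pverts G. graph_dist G x y \<le> r}"
    have B: "finite ?B" "card ?B \<le> (D + 1) ^ r" using card_ball_le[OF xV, of r] by auto
    \<comment> \<open>By the hypothesis on \<open>r\<close>, the ball contains at most half as many
      vertices as \<open>F\<close>.\<close>
    have "card F \<le> card (F - ?B) + card ?B"
      using F B by (metis (no_types, lifting) card_Un_le card_mono finite_Diff finite_UnI Un_Diff_cancel2 sup_ge1 order_trans)
    then have "n / 2 \<le> card (F - ?B)" using B(2) r by (simp add: n_def)
    then have "n / 2 * (real r powr c) powr p \<le> card (F - ?B) * (real r powr c) powr p"
      by (intro mult_right_mono) auto
    also have "\<dots> = (\<Sum>y\<in>F - ?B. (real r powr c) powr p)" by simp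
    also have "\<dots> \<le> (\<Sum>y\<in>F - ?B. ?d x y)"
    proof (intro sum_mono powr_mono2)
      fix y assume y: "y \<in> F - ?B"
      then have yV: "y \<in> pverts G" and d: "r \<le> graph_dist G x y" using F by auto
      have "real r powr c \<le> real (graph_dist G x y) powr c" using c d by (intro powr_mono2) auto
      also have "\<dots> \<le> Lp_dist p M (\<Phi> x) (\<Phi> y)"
        using \<rho>[OF d] largest_compression_le[OF xV yV] by linarith
      finally show "real r powr c \<le> Lp_dist p M (\<Phi> x) (\<Phi> y)" .
    qed (use p in auto)
    also have "\<dots> \<le> (\<Sum>y\<in>F. ?d x y)" using F by (intro sum_mono2) auto
    finally show ?thesis .
  qed
  have "n * (n / 2 * (real r powr c) powr p) = (\<Sum>x\<in>F. n / 2 * (real r powr c) powr p)"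
    by (simp add: n_def)
  also have "\<dots> \<le> (\<Sum>x\<in>F. \<Sum>y\<in>F. ?d x y)" by (intro sum_mono far)
  finally have "cheeger_on G F powr p * (n * (n / 2 * (real r powr c) powr p))
      \<le> cheeger_on G F powr p * (\<Sum>x\<in>F. \<Sum>y\<in>F. ?d x y)"
    by (intro mult_left_mono) auto
  also have "\<dots> \<le> 4 * 2 powr p * n * P.poincare_const p
      * (\<Sum>e\<in>parcs G \<inter> F \<times> F. ?d (fst e) (snd e))"
    unfolding n_def using embedding F p
    by (intro P.Lp_poincare) (auto simp: lipschitz_embedding_def)
  also have "\<dots> \<le> 4 * 2 powr p * n * P.poincare_const p * (D * n)"
    using E C n by (intro mult_left_mono) auto
  \<comment> \<open>The factor 16 collects 4 from \<open>poincare\<close>, 2 from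
    \<open>poincare_const\<close> and 2 from the lower bound \<open>n / 2\<close>.\<close>
  finally have "n\<^sup>2 * (cheeger_on G F * real r powr c) powr p
      \<le> n\<^sup>2 * (16 * 2 powr p * D * (p * (4 * p * D) powr (p - 1)))"
    using h by (simp add: powr_mult P.poincare_const_def power2_eq_square mult_ac)
  then show ?thesis using n by simp
qed

text \<open>Choose \<open>r\<close> of order \<open>ln (card F)\<close> in
  \<open>cheeger_on_powr_bound\<close>. Sets for which this \<open>r\<close> is too small for the
  compression estimate have bounded size, and the degree bound handles them.\<close>

lemma cheeger_on_ln_bound:
  assumes c: "0 < c" "ereal c < map_compression_exponent p G M \<Phi>"
  obtains K where "0 \<le> K"
    "\<And>F. F \<subseteq> pverts G \<Longrightarrow> finite F \<Longrightarrow> 2 \<le> card F \<Longrightarrow> cheeger_on G F * ln (card F) powr c \<le> K"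
proof -
  obtain r0 where r0: "\<And>n. r0 \<le> n \<Longrightarrow> real n powr c \<le> \<rho> n"
    using largest_compression_ge_powr[OF c(2)] by (auto simp: eventually_sequentially)
  define C where "C = (16 * 2 powr p * D * (p * (4 * p * D) powr (p - 1))) powr (1 / p)"
  \<comment> \<open>\<open>L\<close> serves large \<open>r\<close>, where
    \<open>ln (card F) \<le> r * L\<close>; \<open>L1\<close> bounds \<open>ln (card F)\<close> for
    the remaining small \<open>r\<close>.\<close>
  define L where "L = 2 * ln (D + 1) + ln 2"
  define L1 where "L1 = (r0 + 2) * ln (D + 1) + ln 2"
  have L: "0 \<le> L" "0 \<le> L1" by (auto simp: L_def L1_def)
  define K where "K = max (C * L powr c) (2 * D * L1 powr c)"
  have K: "0 \<le> K" by (simp add: K_def C_def le_max_iff_disj)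
  have "cheeger_on G F * ln (card F) powr c \<le> K"
    if F: "F \<subseteq> pverts G" "finite F" "2 \<le> card F" for F
  proof (cases "0 < cheeger_on G F")
    case False
    then have "cheeger_on G F * ln (card F) powr c \<le> 0" by (simp add: mult_le_0_iff)
    with K show ?thesis by simp
  next
    case h: True
    \<comment> \<open>The largest \<open>r\<close> for which the ball bound
      \<open>(D + 1) ^ r\<close> is at most half of \<open>card F\<close>; the floor also gives the
      converse estimate of \<open>ln (card F)\<close>.\<close>
    define r where "r = nat \<lfloor>log (D + 1) (card F / 2)\<rfloor>"
    have D1: "1 < real (D + 1)" using degree_pos by simp
    have l0: "0 \<le> log (D + 1) (card F / 2)" using D1 F by (simp add: zero_le_log_cancel_iff)
    then have rle: "real r \<le> log (D + 1) (card F / 2)" and rgt: "log (D + 1) (card F / 2) < real r + 1"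
      by (auto simp: r_def)
    have "real (D + 1) ^ r \<le> card F / 2"
      using rle D1 F by (simp add: le_log_iff powr_realpow)
    then have r: "2 * (D + 1) ^ r \<le> card F"
      by (simp flip: of_nat_le_iff[where 'a = real])
    have "F \<noteq> {}" using F(3) by auto
    then have "(ln (card F) - ln 2) / ln (D + 1) < real r + 1"
      using rgt F by (simp add: log_def ln_div)
    then have lnF: "ln (card F) < (real r + 1) * ln (D + 1) + ln 2"
      using D1 by (simp add: pos_divide_less_eq)
    show ?thesis
    \<comment> \<open>Besides \<open>r0 \<le> r\<close>, the bound \<open>1 \<le> r\<close> is
      required to absorb \<open>r + 1\<close> into \<open>2 * r\<close> and \<open>ln 2\<close> into
      \<open>r * ln 2\<close>.\<close>
    proof (cases "max r0 1 \<le> r")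
      case True
      have "(cheeger_on G F * real r powr c) powr p
          \<le> 16 * 2 powr p * D * (p * (4 * p * D) powr (p - 1))"
        using True c by (intro cheeger_on_powr_bound F h r r0) auto
      then have "((cheeger_on G F * real r powr c) powr p) powr (1 / p) \<le> C"
        unfolding C_def using p by (intro powr_mono2) auto
      then have hr: "cheeger_on G F * real r powr c \<le> C"
        using p h by (simp add: powr_powr)
      have "ln (card F) \<le> real r * L"
      proof -
        have "(real r + 1) * ln (D + 1) \<le> (2 * real r) * ln (D + 1)"
          using True by (intro mult_right_mono) auto
        moreover have "1 * ln 2 \<le> real r * ln 2" using True by (intro mult_right_mono) auto
        moreover have "real r * L = (2 * real r) * ln (D + 1) + real r * ln 2"
          by (simp add: L_def algebra_simps)
        ultimately show ?thesis using lnF by linarith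
      qed
      then have "ln (card F) powr c \<le> (real r * L) powr c"
        using F c by (intro powr_mono2) auto
      then have "cheeger_on G F * ln (card F) powr c \<le> cheeger_on G F * (real r powr c * L powr c)"
        using h L by (simp add: powr_mult)
      also have "\<dots> \<le> C * L powr c"
        using hr unfolding mult.assoc[symmetric] by (intro mult_right_mono) auto
      finally show ?thesis by (simp add: K_def)
    next
      case False
      then have "(real r + 1) * ln (D + 1) \<le> (r0 + 2) * ln (D + 1)"
        by (intro mult_right_mono) auto
      then have "ln (card F) \<le> L1" using lnF by (simp add: L1_def)
      then have "ln (card F) powr c \<le> L1 powr c" using F c by (intro powr_mono2) auto
      then have "cheeger_on G F * ln (card F) powr c \<le> (2 * D) * L1 powr c"
        using h cheeger_on_le_degree[OF F(1,2)] by (intro mult_mono) auto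
      then show ?thesis by (simp add: K_def)
    qed
  qed
  with K show ?thesis using that by blast
qed

end

section \<open>Choice of the exponent and of the embedding\<close>

theorem theorem1p10:
  fixes G :: "'a pair_pre_digraph" and p \<alpha> c :: real
  assumes "pair_wf_digraph G"
    and "infinite (pverts G)"
    and "Digraph_Component.connected (with_proj G)"
    and "bounded_degree G"
    and "1 \<le> p"
    and "compression_exponent TYPE('b) p G = ereal \<alpha>"
    and "0 < \<alpha>"
    and "c < \<alpha> / (2 - \<alpha>)"
  shows "\<exists>K::real. \<forall>N::nat. 2 \<le> N \<longrightarrow> Sep G N / real N \<le> K / (ln (real N)) powr c"
proof -
  obtain D0 where D0: "\<And>v. v \<in> pverts G \<Longrightarrow> finite {u. v \<rightarrow>\<^bsub>mk_symmetric G\<^esub> u}"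
      "\<And>v. v \<in> pverts G \<Longrightarrow> card {u. v \<rightarrow>\<^bsub>mk_symmetric G\<^esub> u} \<le> D0"
    using \<open>bounded_degree G\<close> unfolding bounded_degree_def by metis
  \<comment> \<open>The successor makes the degree bound positive, as the locale demands.\<close>
  define D where "D = Suc D0"
  have graph: "connected_bounded_graph G D"
  proof (intro connected_bounded_graph.intro connected_bounded_graph_axioms.intro)
    show "card {u. v \<rightarrow>\<^bsub>mk_symmetric G\<^esub> u} \<le> D" if "v \<in> pverts G" for v
      using D0(2)[OF that] by (simp add: D_def)
  qed (use assms D0(1) in \<open>simp_all add: D_def\<close>)
  have emb: "graph_embedding G D p M \<Phi>" if "lipschitz_embedding p G M \<Phi>" for M :: "'b measure" and \<Phi>
    using graph that \<open>1 \<le> p\<close> by (simp add: graph_embedding_def graph_embedding_axioms_def)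
  have sup: "ereal \<alpha> = (SUP (M :: 'b measure, \<Phi>) \<in> {(M, \<Phi>). lipschitz_embedding p G M \<Phi>}.
      map_compression_exponent p G M \<Phi>)"
    using assms(6) by (simp add: compression_exponent_def)
  have "ereal \<alpha> \<le> 1"
    unfolding sup using graph_embedding.map_compression_exponent_le_1[OF emb]
    by (intro SUP_least) auto
  then have \<alpha>1: "\<alpha> \<le> 1" by (simp add: one_ereal_def)
  have "\<alpha> / (2 - \<alpha>) \<le> \<alpha> / 1" using \<alpha>1 \<open>0 < \<alpha>\<close> by (intro divide_left_mono) auto
  then have "max c 0 < \<alpha>" using assms(7,8) by simp
  \<comment> \<open>The exponent \<open>b\<close> is positive even when \<open>c\<close> is not, and
    lies strictly below the supremum \<open>\<alpha>\<close>, so a single embedding exceeds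
    it.\<close>
  then obtain b where b: "max c 0 < b" "b < \<alpha>" using dense by blast
  have "ereal b < (SUP (M :: 'b measure, \<Phi>) \<in> {(M, \<Phi>). lipschitz_embedding p G M \<Phi>}.
      map_compression_exponent p G M \<Phi>)"
    using b(2) sup by (metis less_ereal.simps(1))
  then obtain M :: "'b measure" and \<Phi> where M: "lipschitz_embedding p G M \<Phi>"
      "ereal b < map_compression_exponent p G M \<Phi>"
    unfolding less_SUP_iff by auto
  interpret graph_embedding G D p M \<Phi> using M(1) by (rule emb)
  obtain K where K: "0 \<le> K" "\<And>F. F \<subseteq> pverts G \<Longrightarrow> finite F \<Longrightarrow> 2 \<le> card F \<Longrightarrow>
      cheeger_on G F * ln (card F) powr b \<le> K"
    using cheeger_on_ln_bound[OF _ M(2)] b(1) by auto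
  define K' where "K' = 4 * D + 2 * K"
  have "Sep G N / real N \<le> (K' / ln 2 powr (b - c)) / ln (real N) powr c" if N: "2 \<le> N" for N :: nat
  proof -
    have lnN: "ln 2 \<le> ln (real N)" "0 < ln (real N)" using N by simp_all
    have "Sep G N / N \<le> K' / ln N powr b"
      unfolding K'_def using b \<alpha>1 K N by (intro Sep_le) auto
    \<comment> \<open>Passing from \<open>b\<close> down to \<open>c\<close> costs a constant:
      \<open>ln N\<close> may be below 1, but it is at least \<open>ln 2\<close>.\<close>
    also have "\<dots> \<le> K' / (ln 2 powr (b - c) * ln N powr c)"
    proof (intro divide_left_mono)
      have "ln 2 powr (b - c) * ln N powr c \<le> ln N powr (b - c) * ln N powr c"
        using lnN b by (intro mult_right_mono powr_mono2) auto
      also have "\<dots> = ln N powr b" by (simp flip: powr_add)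
      finally show "ln 2 powr (b - c) * ln N powr c \<le> ln N powr b" .
    qed (use K lnN in \<open>simp_all add: K'_def\<close>)
    finally show ?thesis by simp
  qed
  then show ?thesis by blast
qed

end
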